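(* Let $K$ be an $O$-category, let $\Delta$ be an $\omega$-chain in $K_{\mathrm{PR}}$, and let $\langle C, c\rangle$ be a colimiting cocone for $\Delta$ in $K_{\mathrm{PR}}$. Then $\langle C, c\rangle$ is locally determined if and only if it is preserved by every locally continuous functor, i.e. if and only if for every $O$-category $L$ and every locally continuous functor $F : K \to L$, the cocone $\langle FC, (F_{\mathrm{PR}}\,c_n)_{n\in\mathbb{N}}\rangle$ is a colimiting cocone for the $\omega$-chain $F_{\mathrm{PR}}\circ\Delta$ in $L_{\mathrm{PR}}$.
   Context: An $O$-category is a category each of whose hom-sets is equipped with a partial order having least upper bounds of all $\omega$-chains $f_0 \le f_1 \le \cdots$ (a least element is not required), such that composition is monotone and preserves least upper bounds of $\omega$-chains in each argument. A functor $F : K \to L$ between $O$-categories is locally continuous when its action on each hom-set is monotone and preserves least upper bounds of $\omega$-chains. For an $O$-category $K$, a projection pair $f : A \to B$ is a pair $f = \langle f^L : A \to B,\ f^R : B \to A\rangle$ of morphisms of $K$ with $f^R \circ f^L = \mathrm{id}_A$ and $f^L \circ f^R \le \mathrm{id}_B$. The category $K_{\mathrm{PR}}$ has the objects of $K$ and, as morphisms $A \to B$, the projection pairs $A\to B$, with $(g\circ f)^L = g^L\circ f^L$ and $(g \circ f)^R = f^R \circ g^R$. A locally continuous functor $F : K \to L$ induces a functor $F_{\mathrm{PR}} : K_{\mathrm{PR}} \to L_{\mathrm{PR}}$, acting as $F$ on objects and by $F_{\mathrm{PR}} f = \langle F f^L, F f^R\rangle$ on morphisms. An $\omega$-chain of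 projection pairs is a functor $\Delta : (\mathbb{N},\le) \to K_{\mathrm{PR}}$. A cocone $\langle C, c\rangle$ for it consists of an object $C$ and projection pairs $c_n : \Delta_n \to C$, $n \in\mathbb{N}$, with $c_m\circ\Delta_{n\le m} = c_n$ in $K_{\mathrm{PR}}$ for all $n \le m$; it is colimiting when it is a colimit of $\Delta$ in $K_{\mathrm{PR}}$. For any cocone, the morphisms $c_n^L\circ c_n^R : C \to C$ form an increasing $\omega$-chain in $K(C,C)$. The cocone is locally determined when $\bigvee_{n\in\mathbb{N}} c_n^L\circ c_n^R = \mathrm{id}_C$. *)

theory Defs
  imports Main
begin

section \<open>Categories, functors, colimits\<close>

text \<open>
  Hom-sets are indexed by their end points and need not be disjoint, so composition and the
  action of functors on morphisms carry the end points as arguments: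
  \<open>comp K A B C g f\<close> is the composite of \<open>f : A \<rightarrow> B\<close> and \<open>g : B \<rightarrow> C\<close>.
  Values outside the objects and hom-sets are irrelevant.
\<close>

record ('o, 'm) cat =
  obj :: "'o set"
  hom :: "'o \<Rightarrow> 'o \<Rightarrow> 'm set"
  ident :: "'o \<Rightarrow> 'm"
  comp :: "'o \<Rightarrow> 'o \<Rightarrow> 'o \<Rightarrow> 'm \<Rightarrow> 'm \<Rightarrow> 'm"

locale category =
  fixes K :: "('o, 'm, 'z) cat_scheme"
  assumes ident_in_hom: "A \<in> obj K \<Longrightarrow> ident K A \<in> hom K A A"
    and comp_in_hom:
      "\<lbrakk>A \<in> obj K; B \<in> obj K; C \<in> obj K; f \<in> hom K A B; g \<in> hom K B C\<rbrakk>
        \<Longrightarrow> comp K A B C g f \<in> hom K A C"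
    and comp_ident_right:
      "\<lbrakk>A \<in> obj K; B \<in> obj K; f \<in> hom K A B\<rbrakk> \<Longrightarrow> comp K A A B f (ident K A) = f"
    and comp_ident_left:
      "\<lbrakk>A \<in> obj K; B \<in> obj K; f \<in> hom K A B\<rbrakk> \<Longrightarrow> comp K A B B (ident K B) f = f"
    and comp_assoc:
      "\<lbrakk>A \<in> obj K; B \<in> obj K; C \<in> obj K; D \<in> obj K;
        f \<in> hom K A B; g \<in> hom K B C; h \<in> hom K C D\<rbrakk>
        \<Longrightarrow> comp K A C D h (comp K A B C g f) = comp K A B D (comp K B C D h g) f"

record ('o, 'm, 'p, 'q) func =
  fobj :: "'o \<Rightarrow> 'p"
  fmor :: "'o \<Rightarrow> 'o \<Rightarrow> 'm \<Rightarrow> 'q"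

locale is_functor = K: category K + L: category L
  for K :: "('o, 'm, 'y) cat_scheme" and L :: "('p, 'q, 'z) cat_scheme" +
  fixes F :: "('o, 'm, 'p, 'q) func"
  assumes fobj_in_obj: "A \<in> obj K \<Longrightarrow> fobj F A \<in> obj L"
    and fmor_in_hom:
      "\<lbrakk>A \<in> obj K; B \<in> obj K; f \<in> hom K A B\<rbrakk>
        \<Longrightarrow> fmor F A B f \<in> hom L (fobj F A) (fobj F B)"
    and fmor_ident: "A \<in> obj K \<Longrightarrow> fmor F A A (ident K A) = ident L (fobj F A)"
    and fmor_comp:
      "\<lbrakk>A \<in> obj K; B \<in> obj K; C \<in> obj K; f \<in> hom K A B; g \<in> hom K B C\<rbrakk>
        \<Longrightarrow> fmor F A C (comp K A B C g f)
          = comp L (fobj F A) (fobj F B) (fobj F C) (fmor F B C g) (fmor F A B f)"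

definition func_comp ::
  "('p, 'q, 'r, 's) func \<Rightarrow> ('o, 'm, 'p, 'q) func \<Rightarrow> ('o, 'm, 'r, 's) func"
  (infixr "\<circ>\<^sub>F" 55) where
  "G \<circ>\<^sub>F F =
    \<lparr>fobj = (\<lambda>A. fobj G (fobj F A)),
     fmor = (\<lambda>A B f. fmor G (fobj F A) (fobj F B) (fmor F A B f))\<rparr>"

definition is_cocone ::
  "('i, 'j, 'y) cat_scheme \<Rightarrow> ('o, 'm, 'z) cat_scheme \<Rightarrow> ('i, 'j, 'o, 'm) func
    \<Rightarrow> 'o \<Rightarrow> ('i \<Rightarrow> 'm) \<Rightarrow> bool" where
  "is_cocone J K D C c \<longleftrightarrow>
    C \<in> obj K \<and>
    (\<forall>i\<in>obj J. c i \<in> hom K (fobj D i) C) \<and>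
    (\<forall>i\<in>obj J. \<forall>j\<in>obj J. \<forall>u\<in>hom J i j.
       comp K (fobj D i) (fobj D j) C (c j) (fmor D i j u) = c i)"

definition is_colimit ::
  "('i, 'j, 'y) cat_scheme \<Rightarrow> ('o, 'm, 'z) cat_scheme \<Rightarrow> ('i, 'j, 'o, 'm) func
    \<Rightarrow> 'o \<Rightarrow> ('i \<Rightarrow> 'm) \<Rightarrow> bool" where
  "is_colimit J K D C c \<longleftrightarrow>
    is_cocone J K D C c \<and>
    (\<forall>E d. is_cocone J K D E d \<longrightarrow>
       (\<exists>!k. k \<in> hom K C E \<and> (\<forall>i\<in>obj J. comp K (fobj D i) C E k (c i) = d i)))"

text \<open>The poset \<open>(\<nat>, \<le>)\<close> as a category.\<close>

definition omega :: "(nat, unit) cat" where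
  "omega =
    \<lparr>obj = UNIV,
     hom = (\<lambda>m n. if m \<le> n then {()} else {}),
     ident = (\<lambda>_. ()),
     comp = (\<lambda>_ _ _ _ _. ())\<rparr>"


section \<open>O-categories and locally continuous functors\<close>

record ('o, 'm) ocat = "('o, 'm) cat" +
  hle :: "'o \<Rightarrow> 'o \<Rightarrow> ('m \<times> 'm) set"

definition is_chain :: "('o, 'm, 'z) ocat_scheme \<Rightarrow> 'o \<Rightarrow> 'o \<Rightarrow> (nat \<Rightarrow> 'm) \<Rightarrow> bool" where
  "is_chain K A B f \<longleftrightarrow> (\<forall>n. f n \<in> hom K A B) \<and> (\<forall>n. (f n, f (Suc n)) \<in> hle K A B)"

definition is_lub :: "('o, 'm, 'z) ocat_scheme \<Rightarrow> 'o \<Rightarrow> 'o \<Rightarrow> (nat \<Rightarrow> 'm) \<Rightarrow> 'm \<Rightarrow> bool" where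
  "is_lub K A B f s \<longleftrightarrow>
    s \<in> hom K A B \<and>
    (\<forall>n. (f n, s) \<in> hle K A B) \<and>
    (\<forall>t\<in>hom K A B. (\<forall>n. (f n, t) \<in> hle K A B) \<longrightarrow> (s, t) \<in> hle K A B)"

locale O_category = category K
  for K :: "('o, 'm, 'z) ocat_scheme" +
  assumes hom_order:
      "\<lbrakk>A \<in> obj K; B \<in> obj K\<rbrakk> \<Longrightarrow> partial_order_on (hom K A B) (hle K A B)"
    and lub_exists:
      "\<lbrakk>A \<in> obj K; B \<in> obj K; is_chain K A B X\<rbrakk> \<Longrightarrow> \<exists>s. is_lub K A B X s"
    and comp_mono:
      "\<lbrakk>A \<in> obj K; B \<in> obj K; C \<in> obj K; (f, f') \<in> hle K A B; (g, g') \<in> hle K B C\<rbrakk>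
        \<Longrightarrow> (comp K A B C g f, comp K A B C g' f') \<in> hle K A C"
    and comp_lub_right:
      "\<lbrakk>A \<in> obj K; B \<in> obj K; C \<in> obj K; g \<in> hom K B C; is_chain K A B X; is_lub K A B X s\<rbrakk>
        \<Longrightarrow> is_lub K A C (\<lambda>n. comp K A B C g (X n)) (comp K A B C g s)"
    and comp_lub_left:
      "\<lbrakk>A \<in> obj K; B \<in> obj K; C \<in> obj K; f \<in> hom K A B; is_chain K B C Y; is_lub K B C Y s\<rbrakk>
        \<Longrightarrow> is_lub K A C (\<lambda>n. comp K A B C (Y n) f) (comp K A B C s f)"

locale locally_continuous_functor = K: O_category K + L: O_category L + is_functor K L F
  for K :: "('o, 'm, 'y) ocat_scheme" and L :: "('p, 'q, 'z) ocat_scheme"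
    and F :: "('o, 'm, 'p, 'q) func" +
  assumes fmor_mono:
      "\<lbrakk>A \<in> obj K; B \<in> obj K; (f, g) \<in> hle K A B\<rbrakk>
        \<Longrightarrow> (fmor F A B f, fmor F A B g) \<in> hle L (fobj F A) (fobj F B)"
    and fmor_lub:
      "\<lbrakk>A \<in> obj K; B \<in> obj K; is_chain K A B X; is_lub K A B X s\<rbrakk>
        \<Longrightarrow> is_lub L (fobj F A) (fobj F B) (\<lambda>n. fmor F A B (X n)) (fmor F A B s)"


section \<open>Projection pairs\<close>

text \<open>A projection pair \<open>\<langle>f\<^sup>L, f\<^sup>R\<rangle>\<close> is an ordinary pair, with components \<open>fst f\<close> and \<open>snd f\<close>.\<close>

definition projection_pairs ::
  "('o, 'm, 'z) ocat_scheme \<Rightarrow> 'o \<Rightarrow> 'o \<Rightarrow> ('m \<times> 'm) set" where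
  "projection_pairs K A B =
    {(l, r). l \<in> hom K A B \<and> r \<in> hom K B A \<and>
       comp K A B A r l = ident K A \<and> (comp K B A B l r, ident K B) \<in> hle K B B}"

definition PR :: "('o, 'm, 'z) ocat_scheme \<Rightarrow> ('o, 'm \<times> 'm) cat" where
  "PR K =
    \<lparr>obj = obj K,
     hom = projection_pairs K,
     ident = (\<lambda>A. (ident K A, ident K A)),
     comp = (\<lambda>A B C g f. (comp K A B C (fst g) (fst f), comp K C B A (snd f) (snd g)))\<rparr>"

definition PR_func :: "('o, 'm, 'p, 'q) func \<Rightarrow> ('o, 'm \<times> 'm, 'p, 'q \<times> 'q) func" where
  "PR_func F =
    \<lparr>fobj = fobj F,
     fmor = (\<lambda>A B f. (fmor F A B (fst f), fmor F B A (snd f)))\<rparr>"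

definition locally_determined ::
  "('o, 'm, 'z) ocat_scheme \<Rightarrow> (nat, unit, 'o, 'm \<times> 'm) func
    \<Rightarrow> 'o \<Rightarrow> (nat \<Rightarrow> 'm \<times> 'm) \<Rightarrow> bool" where
  "locally_determined K \<Delta> C c \<longleftrightarrow>
    is_lub K C C (\<lambda>n. comp K C (fobj \<Delta> n) C (fst (c n)) (snd (c n))) (ident K C)"


section \<open>Well-definedness\<close>

lemma category_omega: "category omega"
  by unfold_locales (auto simp: omega_def split: if_splits)

context O_category
begin

lemma hle_in_hom:
  assumes "A \<in> obj K" "B \<in> obj K" "(f, g) \<in> hle K A B"
  shows "f \<in> hom K A B" "g \<in> hom K A B"
  using hom_order[OF assms(1,2)] assms(3)
  by (auto simp: partial_order_on_def preorder_on_def)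

lemma hle_refl: "\<lbrakk>A \<in> obj K; B \<in> obj K; f \<in> hom K A B\<rbrakk> \<Longrightarrow> (f, f) \<in> hle K A B"
  using hom_order by (auto simp: partial_order_on_def preorder_on_def refl_on_def)

lemma hle_trans:
  "\<lbrakk>A \<in> obj K; B \<in> obj K; (f, g) \<in> hle K A B; (g, h) \<in> hle K A B\<rbrakk> \<Longrightarrow> (f, h) \<in> hle K A B"
  using hom_order by (meson partial_order_on_def preorder_on_def transD)

lemma projection_pairs_comp:
  assumes ob: "A \<in> obj K" "B \<in> obj K" "C \<in> obj K"
    and f: "f \<in> projection_pairs K A B" and g: "g \<in> projection_pairs K B C"
  shows "(comp K A B C (fst g) (fst f), comp K C B A (snd f) (snd g)) \<in> projection_pairs K A C"
proof -
  obtain fl fr gl gr where [simp]: "f = (fl, fr)" "g = (gl, gr)" by (cases f, cases g) auto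
  have F: "fl \<in> hom K A B" "fr \<in> hom K B A" "comp K A B A fr fl = ident K A"
      "(comp K B A B fl fr, ident K B) \<in> hle K B B"
    and G: "gl \<in> hom K B C" "gr \<in> hom K C B" "comp K B C B gr gl = ident K B"
      "(comp K C B C gl gr, ident K C) \<in> hle K C C"
    using f g by (auto simp: projection_pairs_def)
  note H = comp_in_hom comp_ident_left comp_ident_right
  have "comp K A C A (comp K C B A fr gr) (comp K A B C gl fl)
      = comp K A B A fr (comp K A C B gr (comp K A B C gl fl))"
    by (rule comp_assoc[symmetric]) (use ob F G in \<open>auto intro: H\<close>)
  also have "comp K A C B gr (comp K A B C gl fl) = comp K A B B (comp K B C B gr gl) fl"
    by (rule comp_assoc) (use ob F G in auto)
  also have "\<dots> = fl" using ob F G by (simp add: H)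
  finally have 1: "comp K A C A (comp K C B A fr gr) (comp K A B C gl fl) = ident K A"
    using F by simp
  have "comp K C A C (comp K A B C gl fl) (comp K C B A fr gr)
      = comp K C B C gl (comp K C A B fl (comp K C B A fr gr))"
    by (rule comp_assoc[symmetric]) (use ob F G in \<open>auto intro: H\<close>)
  also have "comp K C A B fl (comp K C B A fr gr) = comp K C B B (comp K B A B fl fr) gr"
    by (rule comp_assoc) (use ob F G in auto)
  finally have 2: "comp K C A C (comp K A B C gl fl) (comp K C B A fr gr)
      = comp K C B C gl (comp K C B B (comp K B A B fl fr) gr)" .
  have "(comp K C B B (comp K B A B fl fr) gr, comp K C B B (ident K B) gr) \<in> hle K C B"
    using ob F G by (intro comp_mono hle_refl) auto
  then have "(comp K C B B (comp K B A B fl fr) gr, gr) \<in> hle K C B"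
    using ob G by (simp add: H)
  then have "(comp K C B C gl (comp K C B B (comp K B A B fl fr) gr), comp K C B C gl gr)
      \<in> hle K C C"
    using ob G by (intro comp_mono hle_refl) auto
  then have "(comp K C A C (comp K A B C gl fl) (comp K C B A fr gr), ident K C) \<in> hle K C C"
    using 2 G ob by (auto intro: hle_trans)
  with 1 show ?thesis
    using ob F G by (auto simp: projection_pairs_def intro: H)
qed

lemma category_PR: "category (PR K)"
proof
  fix A assume "A \<in> obj (PR K)"
  then show "ident (PR K) A \<in> hom (PR K) A A"
    by (auto simp: PR_def projection_pairs_def ident_in_hom comp_ident_left hle_refl)
next
  fix A B C f g
  assume "A \<in> obj (PR K)" "B \<in> obj (PR K)" "C \<in> obj (PR K)"
    and "f \<in> hom (PR K) A B" "g \<in> hom (PR K) B C"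
  then show "comp (PR K) A B C g f \<in> hom (PR K) A C"
    using projection_pairs_comp[of A B C f g] by (simp add: PR_def)
qed (auto simp: PR_def projection_pairs_def comp_ident_left comp_ident_right comp_assoc)

lemma cocone_is_chain:
  assumes D: "is_functor omega (PR K) \<Delta>" and c: "is_cocone omega (PR K) \<Delta> C c"
  shows "is_chain K C C (\<lambda>n. comp K C (fobj \<Delta> n) C (fst (c n)) (snd (c n)))"
proof -
  interpret D: is_functor omega "PR K" \<Delta> by (rule D)
  have ob: "fobj \<Delta> n \<in> obj K" "C \<in> obj K" for n
    using D.fobj_in_obj[of n] c by (auto simp: omega_def PR_def is_cocone_def)
  have cn: "fst (c n) \<in> hom K (fobj \<Delta> n) C" "snd (c n) \<in> hom K C (fobj \<Delta> n)" for n
    using c by (auto simp: omega_def PR_def is_cocone_def projection_pairs_def case_prod_beta)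
  have step: "(comp K C (fobj \<Delta> n) C (fst (c n)) (snd (c n)),
      comp K C (fobj \<Delta> (Suc n)) C (fst (c (Suc n))) (snd (c (Suc n)))) \<in> hle K C C" for n
  proof -
    define A B g where "A = fobj \<Delta> n" and "B = fobj \<Delta> (Suc n)" and "g = fmor \<Delta> n (Suc n) ()"
    obtain gl gr where g: "g = (gl, gr)" by (cases g)
    obtain el er where e: "c (Suc n) = (el, er)" by (cases "c (Suc n)")
    have AB: "A \<in> obj K" "B \<in> obj K" using ob by (auto simp: A_def B_def)
    have E: "el \<in> hom K B C" "er \<in> hom K C B" using cn[of "Suc n"] e by (auto simp: B_def)
    have "g \<in> projection_pairs K A B"
      using D.fmor_in_hom[of n "Suc n" "()"] by (simp add: g_def A_def B_def omega_def PR_def)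
    then have G: "gl \<in> hom K A B" "gr \<in> hom K B A" "(comp K B A B gl gr, ident K B) \<in> hle K B B"
      by (auto simp: projection_pairs_def g)
    have "comp (PR K) A B C (c (Suc n)) g = c n"
      using c by (auto simp: is_cocone_def omega_def A_def B_def g_def split: if_splits)
    then have cn': "c n = (comp K A B C el gl, comp K C B A gr er)"
      by (simp add: PR_def g e)
    have "comp K C A C (comp K A B C el gl) (comp K C B A gr er)
        = comp K C B C el (comp K C A B gl (comp K C B A gr er))"
      by (rule comp_assoc[symmetric]) (use AB ob E G in \<open>auto intro: comp_in_hom\<close>)
    also have "comp K C A B gl (comp K C B A gr er) = comp K C B B (comp K B A B gl gr) er"
      by (rule comp_assoc) (use AB ob E G in auto)
    finally have 2: "comp K C A C (comp K A B C el gl) (comp K C B A gr er)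
        = comp K C B C el (comp K C B B (comp K B A B gl gr) er)" .
    have "(comp K C B B (comp K B A B gl gr) er, comp K C B B (ident K B) er) \<in> hle K C B"
      using AB ob E G by (intro comp_mono hle_refl) auto
    then have "(comp K C B B (comp K B A B gl gr) er, er) \<in> hle K C B"
      using AB ob E by (simp add: comp_ident_left)
    then have "(comp K C B C el (comp K C B B (comp K B A B gl gr) er), comp K C B C el er)
        \<in> hle K C C"
      using AB ob E by (intro comp_mono hle_refl) auto
    then show ?thesis
      using 2 by (simp add: cn' e A_def[symmetric] B_def[symmetric])
  qed
  show ?thesis
    unfolding is_chain_def using step ob cn by (auto intro: comp_in_hom)
qed

end

lemma (in locally_continuous_functor) is_functor_PR: "is_functor (PR K) (PR L) (PR_func F)"
proof -
  interpret KP: category "PR K" by (rule K.category_PR)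
  interpret LP: category "PR L" by (rule L.category_PR)
  have pp: "(fmor F A B l, fmor F B A r) \<in> projection_pairs L (fobj F A) (fobj F B)"
    if AB: "A \<in> obj K" "B \<in> obj K" and p: "(l, r) \<in> projection_pairs K A B" for A B l r
  proof -
    have lr: "l \<in> hom K A B" "r \<in> hom K B A" "comp K A B A r l = ident K A"
      "(comp K B A B l r, ident K B) \<in> hle K B B"
      using p by (auto simp: projection_pairs_def)
    show ?thesis
      using AB lr fmor_comp[of A B A l r] fmor_comp[of B A B r l] fmor_mono[OF AB(2,2) lr(4)]
      by (simp add: projection_pairs_def fmor_in_hom fmor_ident)
  qed
  show ?thesis
  proof
    fix A B f assume "A \<in> obj (PR K)" "B \<in> obj (PR K)" "f \<in> hom (PR K) A B"
    then show "fmor (PR_func F) A B f \<in> hom (PR L) (fobj (PR_func F) A) (fobj (PR_func F) B)"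
      using pp[of A B "fst f" "snd f"] by (simp add: PR_def PR_func_def)
  qed (auto simp: PR_def PR_func_def projection_pairs_def fobj_in_obj fmor_ident fmor_comp)
qed

end

(*
  Forward direction: a locally continuous functor preserves the equation saying that the lub of
  the c_n^L o c_n^R is the identity, and this equation makes any cocone colimiting: for a second
  cocone e, the lubs of the e_n^L o c_n^R and of the c_n^L o e_n^R form the mediating
  projection pair.

  Converse: p, the lub of the c_n^L o c_n^R, is an idempotent below id_C. Adjoin to K an object X
  splitting p, as in the Karoubi envelope. The pairs c_n also form a cocone with vertex X, so if
  the inclusion of K preserves the colimit there is a mediating k : C -> X. Followed by the
  projection pair (p, p) : X -> C it is the identity of C; as p absorbs k^L, this gives p = id_C.
*)
theory Submission
  imports Defs
begin

section \<open>Least upper bounds of chains of morphisms\<close>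

context O_category
begin

lemma hle_antisym:
  "\<lbrakk>A \<in> obj K; B \<in> obj K; (f, g) \<in> hle K A B; (g, f) \<in> hle K A B\<rbrakk> \<Longrightarrow> f = g"
  using hom_order by (meson partial_order_on_def antisymD)

lemma is_lub_in_hom: "is_lub K A B X s \<Longrightarrow> s \<in> hom K A B"
  by (simp add: is_lub_def)

lemma is_lub_upper: "is_lub K A B X s \<Longrightarrow> (X n, s) \<in> hle K A B"
  by (simp add: is_lub_def)

lemma is_lub_least:
  assumes "A \<in> obj K" "B \<in> obj K" "is_lub K A B X s" "\<And>n. (X n, t) \<in> hle K A B"
  shows "(s, t) \<in> hle K A B"
  using assms hle_in_hom(2)[OF assms(1,2) assms(4)] by (simp add: is_lub_def)

lemma is_lub_unique:
  assumes "A \<in> obj K" "B \<in> obj K" "is_lub K A B X s" "is_lub K A B X t"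
  shows "s = t"
  using assms by (meson hle_antisym is_lub_least is_lub_upper)

lemma is_chain_mono:
  assumes "A \<in> obj K" "B \<in> obj K" "is_chain K A B X" "m \<le> n"
  shows "(X m, X n) \<in> hle K A B"
  using assms(4)
proof (induction n rule: dec_induct)
  case base
  then show ?case using assms by (auto simp: is_chain_def intro: hle_refl)
next
  case (step n)
  then show ?case using assms by (auto simp: is_chain_def intro: hle_trans)
qed

section \<open>Composition of chains and of their lubs\<close>

lemma is_chain_comp_right:
  assumes "A \<in> obj K" "B \<in> obj K" "C \<in> obj K" "g \<in> hom K B C" "is_chain K A B X"
  shows "is_chain K A C (\<lambda>n. comp K A B C g (X n))"
  using assms by (auto simp: is_chain_def intro: comp_in_hom comp_mono hle_refl)

lemma is_chain_comp_left:
  assumes "A \<in> obj K" "B \<in> obj K" "C \<in> obj K" "f \<in> hom K A B" "is_chain K B C Y"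
  shows "is_chain K A C (\<lambda>n. comp K A B C (Y n) f)"
  using assms by (auto simp: is_chain_def intro: comp_in_hom comp_mono hle_refl)

text \<open>Each term lies below a later one, which is \<open>t\<close>. This evaluates the lubs
  that become constant after composition with one leg of a cocone.\<close>

lemma is_lub_eventually_const:
  assumes ob: "A \<in> obj K" "B \<in> obj K" and X: "is_chain K A B X" "is_lub K A B X s"
    and const: "\<And>n. m \<le> n \<Longrightarrow> X n = t"
  shows "s = t"
proof (rule hle_antisym[OF ob])
  have "(X n, t) \<in> hle K A B" for n
    using is_chain_mono[OF ob X(1), of n "max m n"] const[of "max m n"] by simp
  then show "(s, t) \<in> hle K A B" by (rule is_lub_least[OF ob X(2)])
  show "(t, s) \<in> hle K A B" using is_lub_upper[OF X(2), of m] const[of m] by simp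
qed

text \<open>Separate continuity yields joint continuity because the diagonal is cofinal in the
  double family \<open>Y m\<close> o \<open>X n\<close>: each member lies below the diagonal term at
  \<open>max m n\<close>. The lub can then be taken in one variable at a time.\<close>

lemma is_lub_comp:
  assumes ob: "A \<in> obj K" "B \<in> obj K" "C \<in> obj K"
    and X: "is_chain K A B X" "is_lub K A B X s"
    and Y: "is_chain K B C Y" "is_lub K B C Y t"
  shows "is_lub K A C (\<lambda>n. comp K A B C (Y n) (X n)) (comp K A B C t s)"
  unfolding is_lub_def
proof (intro conjI allI ballI impI)
  show "comp K A B C t s \<in> hom K A C"
    using ob X Y by (meson comp_in_hom is_lub_in_hom)
  show "(comp K A B C (Y n) (X n), comp K A B C t s) \<in> hle K A C" for n
    using ob X Y by (meson comp_mono is_lub_upper)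
  fix u assume u: "\<forall>n. (comp K A B C (Y n) (X n), u) \<in> hle K A C"
  have le: "(comp K A B C (Y m) (X n), u) \<in> hle K A C" for m n
  proof -
    have "(comp K A B C (Y m) (X n), comp K A B C (Y (max m n)) (X (max m n))) \<in> hle K A C"
      using ob X Y by (intro comp_mono is_chain_mono) auto
    then show ?thesis using u ob by (meson hle_trans)
  qed
  have "(comp K A B C (Y m) s, u) \<in> hle K A C" for m
  proof (rule is_lub_least)
    show "is_lub K A C (\<lambda>n. comp K A B C (Y m) (X n)) (comp K A B C (Y m) s)"
      using ob X Y by (intro comp_lub_right) (auto simp: is_chain_def)
  qed (use ob le in auto)
  then show "(comp K A B C t s, u) \<in> hle K A C"
    using is_lub_least[OF ob(1,3) comp_lub_left[OF ob is_lub_in_hom[OF X(2)] Y]] by simp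
qed

lemma comp_cancel_middle:
  assumes ob: "A \<in> obj K" "B \<in> obj K" "X \<in> obj K" "C \<in> obj K"
    and "f \<in> hom K A B" "g \<in> hom K B X" "h \<in> hom K X B" "k \<in> hom K B C"
    and "comp K B X B h g = ident K B"
  shows "comp K A X C (comp K X B C k h) (comp K A B X g f) = comp K A B C k f"
proof -
  have "comp K A X C (comp K X B C k h) (comp K A B X g f)
      = comp K A B C k (comp K A X B h (comp K A B X g f))"
    using assms by (intro comp_assoc[symmetric] comp_in_hom) auto
  also have "comp K A X B h (comp K A B X g f) = f"
    using assms by (simp add: comp_assoc comp_ident_left)
  finally show ?thesis .
qed

end


section \<open>Locally determined cocones are colimiting\<close>

lemma is_functor_func_comp:
  assumes "is_functor J K D" "is_functor K L G"
  shows "is_functor J L (G \<circ>\<^sub>F D)"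
proof -
  interpret D: is_functor J K D by fact
  interpret G: is_functor K L G by fact
  show ?thesis
    by unfold_locales
      (auto simp: func_comp_def D.fobj_in_obj D.fmor_in_hom D.fmor_ident D.fmor_comp
        G.fobj_in_obj G.fmor_in_hom G.fmor_ident G.fmor_comp)
qed

lemma is_cocone_func_comp:
  assumes "is_functor J K D" "is_functor K L G" "is_cocone J K D C c"
  shows "is_cocone J L (G \<circ>\<^sub>F D) (fobj G C) (\<lambda>i. fmor G (fobj D i) C (c i))"
proof -
  interpret D: is_functor J K D by fact
  interpret G: is_functor K L G by fact
  show ?thesis
    using assms(3)
    by (auto simp: is_cocone_def func_comp_def D.fobj_in_obj D.fmor_in_hom
        G.fobj_in_obj G.fmor_in_hom G.fmor_comp[symmetric])
qed

lemma is_cocone_omega_PR_iff: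
  "is_cocone omega (PR K) D C c \<longleftrightarrow>
    C \<in> obj K \<and> (\<forall>n. c n \<in> projection_pairs K (fobj D n) C) \<and>
    (\<forall>m n. m \<le> n \<longrightarrow>
      comp K (fobj D m) (fobj D n) C (fst (c n)) (fst (fmor D m n ())) = fst (c m) \<and>
      comp K C (fobj D n) (fobj D m) (snd (fmor D m n ())) (snd (c n)) = snd (c m))"
  by (auto simp: is_cocone_def omega_def PR_def prod_eq_iff)

section \<open>Cocones over a fixed chain of projection pairs\<close>

locale projection_chain = O_category K + D: is_functor omega "PR K" \<Delta>
  for K :: "('o, 'm, 'z) ocat_scheme" and \<Delta> :: "(nat, unit, 'o, 'm \<times> 'm) func"
begin

abbreviation cocone :: "'o \<Rightarrow> (nat \<Rightarrow> 'm \<times> 'm) \<Rightarrow> bool" where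
  "cocone \<equiv> is_cocone omega (PR K) \<Delta>"

lemma obj_chain: "fobj \<Delta> n \<in> obj K"
  using D.fobj_in_obj[of n] by (simp add: omega_def PR_def)

lemma cocone_obj: "cocone C c \<Longrightarrow> C \<in> obj K"
  by (simp add: is_cocone_omega_PR_iff)

lemma chain_pair:
  assumes "m \<le> n"
  shows "fst (fmor \<Delta> m n ()) \<in> hom K (fobj \<Delta> m) (fobj \<Delta> n)"
    and "snd (fmor \<Delta> m n ()) \<in> hom K (fobj \<Delta> n) (fobj \<Delta> m)"
    and "(comp K (fobj \<Delta> n) (fobj \<Delta> m) (fobj \<Delta> n) (fst (fmor \<Delta> m n ())) (snd (fmor \<Delta> m n ())),
      ident K (fobj \<Delta> n)) \<in> hle K (fobj \<Delta> n) (fobj \<Delta> n)"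
  using D.fmor_in_hom[of m n "()"] assms
  by (auto simp: omega_def PR_def projection_pairs_def)

lemma cocone_pair:
  assumes "cocone C c"
  shows "fst (c n) \<in> hom K (fobj \<Delta> n) C" and "snd (c n) \<in> hom K C (fobj \<Delta> n)"
    and "comp K (fobj \<Delta> n) C (fobj \<Delta> n) (snd (c n)) (fst (c n)) = ident K (fobj \<Delta> n)"
    and "(comp K C (fobj \<Delta> n) C (fst (c n)) (snd (c n)), ident K C) \<in> hle K C C"
  using assms by (auto simp: is_cocone_omega_PR_iff projection_pairs_def case_prod_beta)

lemma cocone_natural:
  assumes "cocone C c" "m \<le> n"
  shows "comp K (fobj \<Delta> m) (fobj \<Delta> n) C (fst (c n)) (fst (fmor \<Delta> m n ())) = fst (c m)"
    and "comp K C (fobj \<Delta> n) (fobj \<Delta> m) (snd (fmor \<Delta> m n ())) (snd (c n)) = snd (c m)"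
  using assms by (auto simp: is_cocone_omega_PR_iff)

text \<open>Factoring c_m through c_n brings c_n^R next to c_n^L, and the two cancel. The result
  does not depend on the cocone, so legs of different cocones can be compared.\<close>

lemma cocone_transition:
  assumes c: "cocone C c" and "m \<le> n"
  shows "comp K (fobj \<Delta> m) C (fobj \<Delta> n) (snd (c n)) (fst (c m)) = fst (fmor \<Delta> m n ())"
    and "comp K (fobj \<Delta> n) C (fobj \<Delta> m) (snd (c m)) (fst (c n)) = snd (fmor \<Delta> m n ())"
proof -
  note H = obj_chain cocone_obj[OF c] cocone_pair[OF c] chain_pair[OF \<open>m \<le> n\<close>]
  show "comp K (fobj \<Delta> m) C (fobj \<Delta> n) (snd (c n)) (fst (c m)) = fst (fmor \<Delta> m n ())"
    by (subst cocone_natural(1)[OF assms, symmetric]) (simp add: comp_assoc H comp_ident_left)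
  show "comp K (fobj \<Delta> n) C (fobj \<Delta> m) (snd (c m)) (fst (c n)) = snd (fmor \<Delta> m n ())"
    by (subst cocone_natural(2)[OF assms, symmetric])
      (simp add: comp_assoc[symmetric] H comp_ident_right)
qed

text \<open>With g the transition from n to n+1, the n-th term is e_(n+1)^L o (g^L o g^R) o
  c_(n+1)^R, and g^L o g^R \<le> id. The case of equal cocones is the chain in the definition of
  local determinacy.\<close>

lemma is_chain_cocones:
  assumes c: "cocone C c" and e: "cocone E e"
  shows "is_chain K C E (\<lambda>n. comp K C (fobj \<Delta> n) E (fst (e n)) (snd (c n)))"
  unfolding is_chain_def
proof (intro conjI allI)
  fix n
  note H = obj_chain cocone_obj[OF c] cocone_obj[OF e] cocone_pair[OF c] cocone_pair[OF e]
    chain_pair[of n "Suc n", simplified]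
  show "comp K C (fobj \<Delta> n) E (fst (e n)) (snd (c n)) \<in> hom K C E"
    by (intro comp_in_hom H)
  let ?A = "fobj \<Delta> n" and ?B = "fobj \<Delta> (Suc n)" and ?g = "fmor \<Delta> n (Suc n) ()"
  have "comp K C ?A E (fst (e n)) (snd (c n))
      = comp K C ?A E (comp K ?A ?B E (fst (e (Suc n))) (fst ?g))
          (comp K C ?B ?A (snd ?g) (snd (c (Suc n))))"
    using cocone_natural(1)[OF e, of n "Suc n"] cocone_natural(2)[OF c, of n "Suc n"] by simp
  also have "\<dots> = comp K C ?B E (fst (e (Suc n)))
      (comp K C ?B ?B (comp K ?B ?A ?B (fst ?g) (snd ?g)) (snd (c (Suc n))))"
    using H by (simp add: comp_assoc comp_in_hom)
  finally have eq: "comp K C ?A E (fst (e n)) (snd (c n)) = \<dots>" .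
  have "(comp K C ?B ?B (comp K ?B ?A ?B (fst ?g) (snd ?g)) (snd (c (Suc n))),
      comp K C ?B ?B (ident K ?B) (snd (c (Suc n)))) \<in> hle K C ?B"
    by (intro comp_mono hle_refl H)
  then show "(comp K C ?A E (fst (e n)) (snd (c n)),
      comp K C ?B E (fst (e (Suc n))) (snd (c (Suc n)))) \<in> hle K C E"
    unfolding eq using H by (intro comp_mono hle_refl) (auto simp: comp_ident_left)
qed

text \<open>After composition with c_m^L the chain is constant from index m on: c_n^R o c_m^L is a
  transition of \<Delta>, which e_n^L absorbs by naturality. Dually for e_m^R. Hence the lub from C
  to E mediates the left components, and the lub in the other direction the right ones.\<close>

lemma lub_cocones_comp:
  assumes c: "cocone C c" and e: "cocone E e"
    and s: "is_lub K C E (\<lambda>n. comp K C (fobj \<Delta> n) E (fst (e n)) (snd (c n))) s"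
  shows "comp K (fobj \<Delta> m) C E s (fst (c m)) = fst (e m)"
    and "comp K C E (fobj \<Delta> m) (snd (e m)) s = snd (c m)"
proof -
  note H = obj_chain cocone_obj[OF c] cocone_obj[OF e] cocone_pair[OF c] cocone_pair[OF e]
  note ch = is_chain_cocones[OF c e]
  show "comp K (fobj \<Delta> m) C E s (fst (c m)) = fst (e m)"
  proof (rule is_lub_eventually_const)
    show "is_lub K (fobj \<Delta> m) E
        (\<lambda>n. comp K (fobj \<Delta> m) C E (comp K C (fobj \<Delta> n) E (fst (e n)) (snd (c n))) (fst (c m)))
        (comp K (fobj \<Delta> m) C E s (fst (c m)))"
      by (rule comp_lub_left) (use H ch s in auto)
    show "is_chain K (fobj \<Delta> m) E
        (\<lambda>n. comp K (fobj \<Delta> m) C E (comp K C (fobj \<Delta> n) E (fst (e n)) (snd (c n))) (fst (c m)))"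
      by (rule is_chain_comp_left) (use H ch in auto)
    show "comp K (fobj \<Delta> m) C E (comp K C (fobj \<Delta> n) E (fst (e n)) (snd (c n))) (fst (c m))
        = fst (e m)" if "m \<le> n" for n
      using H cocone_transition(1)[OF c that] cocone_natural(1)[OF e that]
      by (simp add: comp_assoc[symmetric])
  qed (use H in auto)
  show "comp K C E (fobj \<Delta> m) (snd (e m)) s = snd (c m)"
  proof (rule is_lub_eventually_const)
    show "is_lub K C (fobj \<Delta> m)
        (\<lambda>n. comp K C E (fobj \<Delta> m) (snd (e m)) (comp K C (fobj \<Delta> n) E (fst (e n)) (snd (c n))))
        (comp K C E (fobj \<Delta> m) (snd (e m)) s)"
      by (rule comp_lub_right) (use H ch s in auto)
    show "is_chain K C (fobj \<Delta> m)
        (\<lambda>n. comp K C E (fobj \<Delta> m) (snd (e m)) (comp K C (fobj \<Delta> n) E (fst (e n)) (snd (c n))))"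
      by (rule is_chain_comp_right) (use H ch in auto)
    show "comp K C E (fobj \<Delta> m) (snd (e m)) (comp K C (fobj \<Delta> n) E (fst (e n)) (snd (c n)))
        = snd (c m)" if "m \<le> n" for n
      using H cocone_transition(2)[OF e that] cocone_natural(2)[OF c that]
      by (simp add: comp_assoc)
  qed (use H in auto)
qed

text \<open>Comparison lubs compose because their n-th terms do. Choosing the three cocones as c, e,
  c or e, c, e treats the two composites of a mediating pair; c, c, c gives idempotence of the lub
  of the c_n^L o c_n^R.\<close>

lemma lub_cocones_comp_lub:
  assumes c: "cocone C c" and e: "cocone E e" and d: "cocone B d"
    and s: "is_lub K C E (\<lambda>n. comp K C (fobj \<Delta> n) E (fst (e n)) (snd (c n))) s"
    and t: "is_lub K E B (\<lambda>n. comp K E (fobj \<Delta> n) B (fst (d n)) (snd (e n))) t"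
  shows "is_lub K C B (\<lambda>n. comp K C (fobj \<Delta> n) B (fst (d n)) (snd (c n))) (comp K C E B t s)"
proof -
  note H = obj_chain cocone_obj[OF c] cocone_obj[OF e] cocone_obj[OF d]
    cocone_pair[OF c] cocone_pair[OF e] cocone_pair[OF d]
  \<comment> \<open>The factor e_n^R o e_n^L in the middle is an identity.\<close>
  have "comp K C E B (comp K E (fobj \<Delta> n) B (fst (d n)) (snd (e n)))
        (comp K C (fobj \<Delta> n) E (fst (e n)) (snd (c n)))
      = comp K C (fobj \<Delta> n) B (fst (d n)) (snd (c n))" for n
    by (rule comp_cancel_middle) (use H in auto)
  then show ?thesis
    using is_lub_comp[OF H(2,3,4) is_chain_cocones[OF c e] s is_chain_cocones[OF e d] t] by simp
qed

lemma locally_determined_is_colimit: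
  assumes c: "cocone C c" and ld: "locally_determined K \<Delta> C c"
  shows "is_colimit omega (PR K) \<Delta> C c"
  unfolding is_colimit_def
proof (intro conjI allI impI)
  fix E e assume e: "cocone E e"
  note H = obj_chain cocone_obj[OF c] cocone_obj[OF e] cocone_pair[OF c] cocone_pair[OF e]
  obtain l where l: "is_lub K C E (\<lambda>n. comp K C (fobj \<Delta> n) E (fst (e n)) (snd (c n))) l"
    using lub_exists[OF H(2,3) is_chain_cocones[OF c e]] by blast
  obtain r where r: "is_lub K E C (\<lambda>n. comp K E (fobj \<Delta> n) C (fst (c n)) (snd (e n))) r"
    using lub_exists[OF H(3,2) is_chain_cocones[OF e c]] by blast
  note ld = ld[unfolded locally_determined_def]
  have lr_hom: "l \<in> hom K C E" "r \<in> hom K E C"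
    using l r by (auto intro: is_lub_in_hom)
  \<comment> \<open>The composite is the lub of the c_n^L o c_n^R, which local determinacy makes the
    identity.\<close>
  have rl: "comp K C E C r l = ident K C"
    using is_lub_unique[OF H(2,2) lub_cocones_comp_lub[OF c e c l r] ld] .
  \<comment> \<open>Here the composite is the lub of the e_n^L o e_n^R, each of them below the
    identity.\<close>
  have lr: "(comp K E C E l r, ident K E) \<in> hle K E E"
    by (rule is_lub_least[OF H(3,3) lub_cocones_comp_lub[OF e c e r l]]) (use H in auto)
  show "\<exists>!k. k \<in> hom (PR K) C E \<and>
      (\<forall>n\<in>obj omega. comp (PR K) (fobj \<Delta> n) C E k (c n) = e n)"
  proof (rule ex1I[of _ "(l, r)"])
    show "(l, r) \<in> hom (PR K) C E \<and>
        (\<forall>n\<in>obj omega. comp (PR K) (fobj \<Delta> n) C E (l, r) (c n) = e n)"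
      using lr_hom rl lr lub_cocones_comp(1)[OF c e l] lub_cocones_comp(2)[OF e c r]
      by (auto simp: PR_def projection_pairs_def)
  next
    fix k assume k: "k \<in> hom (PR K) C E \<and>
        (\<forall>n\<in>obj omega. comp (PR K) (fobj \<Delta> n) C E k (c n) = e n)"
    then have kh: "fst k \<in> hom K C E" "snd k \<in> hom K E C"
      and kc: "comp K (fobj \<Delta> n) C E (fst k) (fst (c n)) = fst (e n)"
        "comp K E C (fobj \<Delta> n) (snd (c n)) (snd k) = snd (e n)" for n
      by (auto simp: PR_def projection_pairs_def omega_def prod_eq_iff)
    \<comment> \<open>Uniqueness: writing the identity of C as the lub of the c_n^L o c_n^R makes
      k^L the lub of k^L o c_n^L o c_n^R = e_n^L o c_n^R, the chain that defines \<open>l\<close>.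
      The right component is symmetric.\<close>
    have "is_lub K C E (\<lambda>n. comp K C C E (fst k) (comp K C (fobj \<Delta> n) C (fst (c n)) (snd (c n))))
        (comp K C C E (fst k) (ident K C))"
      by (rule comp_lub_right) (use H kh ld is_chain_cocones[OF c c] in auto)
    then have "fst k = l"
      using is_lub_unique[OF H(2,3) _ l] kc kh H by (simp add: comp_assoc comp_ident_right)
    have "is_lub K E C (\<lambda>n. comp K E C C (comp K C (fobj \<Delta> n) C (fst (c n)) (snd (c n))) (snd k))
        (comp K E C C (ident K C) (snd k))"
      by (rule comp_lub_left) (use H kh ld is_chain_cocones[OF c c] in auto)
    then have "snd k = r"
      using is_lub_unique[OF H(3,2) _ r] kc kh H
      by (simp add: comp_assoc[symmetric] comp_ident_left)
    with \<open>fst k = l\<close> show "k = (l, r)" by auto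
  qed
qed (rule c)

end

text \<open>What is transported along F is local determinacy, an equation about a lub; the universal
  property in L is then obtained afresh from it.\<close>

lemma (in locally_continuous_functor) preserves_locally_determined:
  assumes D: "is_functor omega (PR K) \<Delta>" and c: "is_cocone omega (PR K) \<Delta> C c"
    and ld: "locally_determined K \<Delta> C c"
  shows "is_colimit omega (PR L) (PR_func F \<circ>\<^sub>F \<Delta>)
    (fobj F C) (\<lambda>n. fmor (PR_func F) (fobj \<Delta> n) C (c n))"
proof -
  interpret \<Delta>: projection_chain K \<Delta>
    using K.O_category_axioms D by (simp add: projection_chain_def)
  interpret F\<Delta>: projection_chain L "PR_func F \<circ>\<^sub>F \<Delta>"
    using L.O_category_axioms is_functor_func_comp[OF D is_functor_PR]
    by (simp add: projection_chain_def)
  note H = \<Delta>.obj_chain \<Delta>.cocone_obj[OF c] \<Delta>.cocone_pair[OF c]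
  have "is_lub L (fobj F C) (fobj F C)
      (\<lambda>n. fmor F C C (comp K C (fobj \<Delta> n) C (fst (c n)) (snd (c n)))) (fmor F C C (ident K C))"
    using fmor_lub[OF H(2,2) \<Delta>.is_chain_cocones[OF c c] ld[unfolded locally_determined_def]] .
  then have "locally_determined L (PR_func F \<circ>\<^sub>F \<Delta>) (fobj F C)
      (\<lambda>n. fmor (PR_func F) (fobj \<Delta> n) C (c n))"
    using H by (simp add: locally_determined_def func_comp_def PR_func_def fmor_ident fmor_comp)
  moreover have "is_cocone omega (PR L) (PR_func F \<circ>\<^sub>F \<Delta>)
      (fobj F C) (\<lambda>n. fmor (PR_func F) (fobj \<Delta> n) C (c n))"
    using is_cocone_func_comp[OF D is_functor_PR c] by (simp add: PR_func_def)
  ultimately show ?thesis by (intro F\<Delta>.locally_determined_is_colimit)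
qed


section \<open>Splitting idempotents\<close>

text \<open>For idempotents this is the Karoubi condition f = e_Y o f o e_X, stated as two
  absorption equations, each of which is used separately.\<close>

definition splitting_hom ::
  "('o, 'm, 'z) ocat_scheme \<Rightarrow> ('p \<Rightarrow> 'o) \<Rightarrow> ('p \<Rightarrow> 'm) \<Rightarrow> 'p \<Rightarrow> 'p \<Rightarrow> 'm set" where
  "splitting_hom K u e X Y =
    {f \<in> hom K (u X) (u Y).
      comp K (u X) (u Y) (u Y) (e Y) f = f \<and> comp K (u X) (u X) (u Y) f (e X) = f}"

text \<open>The full subcategory of the Karoubi envelope on the idempotents \<open>e X : u X \<rightarrow> u X\<close>,
  \<open>X \<in> I\<close>.\<close>

definition splitting ::
  "('o, 'm, 'z) ocat_scheme \<Rightarrow> 'p set \<Rightarrow> ('p \<Rightarrow> 'o) \<Rightarrow> ('p \<Rightarrow> 'm) \<Rightarrow> ('p, 'm) ocat" where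
  "splitting K I u e =
    \<lparr>obj = I,
     hom = splitting_hom K u e,
     ident = e,
     comp = (\<lambda>X Y Z. comp K (u X) (u Y) (u Z)),
     hle = (\<lambda>X Y. hle K (u X) (u Y) \<inter> splitting_hom K u e X Y \<times> splitting_hom K u e X Y)\<rparr>"

text \<open>Objects are indices, and \<open>u\<close> may fail to be injective, so that one object
  of K can carry several idempotents. Below, C carries its identity at \<open>Some C\<close> and
  \<open>p\<close> at \<open>None\<close>.\<close>

locale idempotent_family = O_category K
  for K :: "('o, 'm, 'z) ocat_scheme" +
  fixes I :: "'p set" and u :: "'p \<Rightarrow> 'o" and e :: "'p \<Rightarrow> 'm"
  assumes u_obj: "X \<in> I \<Longrightarrow> u X \<in> obj K"
    and e_hom: "X \<in> I \<Longrightarrow> e X \<in> hom K (u X) (u X)"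
    and e_idem: "X \<in> I \<Longrightarrow> comp K (u X) (u X) (u X) (e X) (e X) = e X"
begin

lemma splitting_hom_comp:
  assumes "X \<in> I" "Y \<in> I" "Z \<in> I"
    and "f \<in> splitting_hom K u e X Y" "g \<in> splitting_hom K u e Y Z"
  shows "comp K (u X) (u Y) (u Z) g f \<in> splitting_hom K u e X Z"
proof -
  note ob = u_obj[OF assms(1)] u_obj[OF assms(2)] u_obj[OF assms(3)]
  have f: "f \<in> hom K (u X) (u Y)" "comp K (u X) (u X) (u Y) f (e X) = f"
    and g: "g \<in> hom K (u Y) (u Z)" "comp K (u Y) (u Z) (u Z) (e Z) g = g"
    using assms(4,5) by (auto simp: splitting_hom_def)
  show ?thesis
    using comp_assoc[OF ob(1,2,3,3) f(1) g(1) e_hom[OF assms(3)]]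
      comp_assoc[OF ob(1,1,2,3) e_hom[OF assms(1)] f(1) g(1)]
    by (simp add: splitting_hom_def f g comp_in_hom[OF ob f(1) g(1)])
qed

text \<open>Composing with \<open>e Y\<close> fixes every term of the chain, so by continuity
  \<open>e Y\<close> o s is a lub of the same chain and equals s. The same holds for
  \<open>e X\<close> on the other side.\<close>

lemma splitting_lub_hom:
  assumes I: "X \<in> I" "Y \<in> I" and S: "is_chain (splitting K I u e) X Y S"
    and s: "is_lub K (u X) (u Y) S s"
  shows "s \<in> splitting_hom K u e X Y"
proof -
  have S_hom: "S n \<in> splitting_hom K u e X Y" for n
    using S by (simp add: is_chain_def splitting_def)
  have ch: "is_chain K (u X) (u Y) S"
    using S by (auto simp: is_chain_def splitting_def splitting_hom_def)
  have "is_lub K (u X) (u Y) S (comp K (u X) (u Y) (u Y) (e Y) s)"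
    using comp_lub_right[OF u_obj[OF I(1)] u_obj[OF I(2)] u_obj[OF I(2)] e_hom[OF I(2)] ch s] S_hom
    by (simp add: splitting_hom_def)
  moreover have "is_lub K (u X) (u Y) S (comp K (u X) (u X) (u Y) s (e X))"
    using comp_lub_left[OF u_obj[OF I(1)] u_obj[OF I(1)] u_obj[OF I(2)] e_hom[OF I(1)] ch s] S_hom
    by (simp add: splitting_hom_def)
  ultimately show ?thesis
    using is_lub_unique[OF u_obj[OF I(1)] u_obj[OF I(2)] _ s] is_lub_in_hom[OF s]
    unfolding splitting_hom_def by blast
qed

lemma splitting_chain_iff:
  "is_chain (splitting K I u e) X Y S \<longleftrightarrow>
    is_chain K (u X) (u Y) S \<and> (\<forall>n. S n \<in> splitting_hom K u e X Y)"
  by (auto simp: is_chain_def splitting_def splitting_hom_def)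

text \<open>A lub taken in K stays in the restricted hom-set and is therefore also a lub there;
  antisymmetry identifies it with any other. This reduces all continuity claims about the splitting
  to K.\<close>

lemma splitting_lub_iff:
  assumes I: "X \<in> I" "Y \<in> I" and S: "is_chain (splitting K I u e) X Y S"
  shows "is_lub (splitting K I u e) X Y S s \<longleftrightarrow> is_lub K (u X) (u Y) S s"
proof -
  have S': "is_chain K (u X) (u Y) S" "S n \<in> splitting_hom K u e X Y" for n
    using S by (auto simp: splitting_chain_iff)
  have imp: "is_lub (splitting K I u e) X Y S t" if t: "is_lub K (u X) (u Y) S t" for t
    using t splitting_lub_hom[OF I S t] S'
    by (auto simp: is_lub_def splitting_def splitting_hom_def)
  obtain t where t: "is_lub K (u X) (u Y) S t"
    using lub_exists[OF u_obj[OF I(1)] u_obj[OF I(2)] S'(1)] by blast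
  have "s = t" if s: "is_lub (splitting K I u e) X Y S s"
  proof (rule hle_antisym[OF u_obj[OF I(1)] u_obj[OF I(2)]])
    show "(s, t) \<in> hle K (u X) (u Y)" "(t, s) \<in> hle K (u X) (u Y)"
      using s imp[OF t] by (auto simp: is_lub_def splitting_def)
  qed
  then show ?thesis using t imp by blast
qed

text \<open>Composition, order and lubs are those of K on smaller hom-sets. Only the identities
  change, and absorption makes \<open>e X\<close> neutral.\<close>

lemma O_category_splitting: "O_category (splitting K I u e)"
proof
  fix X assume "X \<in> obj (splitting K I u e)"
  then show "ident (splitting K I u e) X \<in> hom (splitting K I u e) X X"
    by (simp add: splitting_def splitting_hom_def e_hom e_idem)
next
  fix X Y Z f g
  assume "X \<in> obj (splitting K I u e)" "Y \<in> obj (splitting K I u e)"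
    "Z \<in> obj (splitting K I u e)"
    and "f \<in> hom (splitting K I u e) X Y" "g \<in> hom (splitting K I u e) Y Z"
  then show "comp (splitting K I u e) X Y Z g f \<in> hom (splitting K I u e) X Z"
    by (simp add: splitting_def splitting_hom_comp)
next
  fix X Y assume I: "X \<in> obj (splitting K I u e)" "Y \<in> obj (splitting K I u e)"
  then have po: "partial_order_on (hom K (u X) (u Y)) (hle K (u X) (u Y))"
    by (simp add: splitting_def hom_order u_obj)
  have sub: "splitting_hom K u e X Y \<subseteq> hom K (u X) (u Y)"
    by (auto simp: splitting_hom_def)
  then show "partial_order_on (hom (splitting K I u e) X Y) (hle (splitting K I u e) X Y)"
    using po
    by (simp add: splitting_def partial_order_on_def preorder_on_def refl_on_def trans_on_def
        antisym_on_def) (use sub in blast)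
next
  fix X Y S assume I: "X \<in> obj (splitting K I u e)" "Y \<in> obj (splitting K I u e)"
    and S: "is_chain (splitting K I u e) X Y S"
  then have I': "X \<in> I" "Y \<in> I" by (auto simp: splitting_def)
  obtain s where "is_lub K (u X) (u Y) S s"
    using lub_exists[OF u_obj[OF I'(1)] u_obj[OF I'(2)]] S by (auto simp: splitting_chain_iff)
  then show "\<exists>s. is_lub (splitting K I u e) X Y S s"
    using splitting_lub_iff[OF I' S] by blast
next
  fix X Y Z f f' g g'
  assume "X \<in> obj (splitting K I u e)" "Y \<in> obj (splitting K I u e)"
    "Z \<in> obj (splitting K I u e)"
    and "(f, f') \<in> hle (splitting K I u e) X Y" "(g, g') \<in> hle (splitting K I u e) Y Z"
  then show "(comp (splitting K I u e) X Y Z g f, comp (splitting K I u e) X Y Z g' f')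
      \<in> hle (splitting K I u e) X Z"
    by (auto simp: splitting_def splitting_hom_comp comp_mono u_obj)
next
  fix X Y Z g S s
  assume I: "X \<in> obj (splitting K I u e)" "Y \<in> obj (splitting K I u e)"
    "Z \<in> obj (splitting K I u e)"
    and g: "g \<in> hom (splitting K I u e) Y Z"
    and S: "is_chain (splitting K I u e) X Y S" and s: "is_lub (splitting K I u e) X Y S s"
  from I have I': "X \<in> I" "Y \<in> I" "Z \<in> I" by (auto simp: splitting_def)
  from g have g': "g \<in> splitting_hom K u e Y Z" by (simp add: splitting_def)
  then have gK: "g \<in> hom K (u Y) (u Z)" by (simp add: splitting_hom_def)
  from S have S': "is_chain K (u X) (u Y) S" "\<And>n. S n \<in> splitting_hom K u e X Y"
    by (auto simp: splitting_chain_iff)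
  have ch: "is_chain (splitting K I u e) X Z (\<lambda>n. comp K (u X) (u Y) (u Z) g (S n))"
    using S' gK g' I' u_obj
    by (auto simp: splitting_chain_iff intro: is_chain_comp_right splitting_hom_comp)
  have "is_lub K (u X) (u Z) (\<lambda>n. comp K (u X) (u Y) (u Z) g (S n)) (comp K (u X) (u Y) (u Z) g s)"
    using I' gK S' s splitting_lub_iff[OF I'(1,2) S] u_obj by (intro comp_lub_right) auto
  then show "is_lub (splitting K I u e) X Z (\<lambda>n. comp (splitting K I u e) X Y Z g (S n))
      (comp (splitting K I u e) X Y Z g s)"
    using splitting_lub_iff[OF I'(1,3) ch] by (simp add: splitting_def)
next
  fix X Y Z f S s
  assume I: "X \<in> obj (splitting K I u e)" "Y \<in> obj (splitting K I u e)"
    "Z \<in> obj (splitting K I u e)"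
    and f: "f \<in> hom (splitting K I u e) X Y"
    and S: "is_chain (splitting K I u e) Y Z S" and s: "is_lub (splitting K I u e) Y Z S s"
  from I have I': "X \<in> I" "Y \<in> I" "Z \<in> I" by (auto simp: splitting_def)
  from f have f': "f \<in> splitting_hom K u e X Y" by (simp add: splitting_def)
  then have fK: "f \<in> hom K (u X) (u Y)" by (simp add: splitting_hom_def)
  from S have S': "is_chain K (u Y) (u Z) S" "\<And>n. S n \<in> splitting_hom K u e Y Z"
    by (auto simp: splitting_chain_iff)
  have ch: "is_chain (splitting K I u e) X Z (\<lambda>n. comp K (u X) (u Y) (u Z) (S n) f)"
    using S' fK f' I' u_obj
    by (auto simp: splitting_chain_iff intro: is_chain_comp_left splitting_hom_comp)
  have "is_lub K (u X) (u Z) (\<lambda>n. comp K (u X) (u Y) (u Z) (S n) f) (comp K (u X) (u Y) (u Z) s f)"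
    using I' fK S' s splitting_lub_iff[OF I'(2,3) S] u_obj by (intro comp_lub_left) auto
  then show "is_lub (splitting K I u e) X Z (\<lambda>n. comp (splitting K I u e) X Y Z (S n) f)
      (comp (splitting K I u e) X Y Z s f)"
    using splitting_lub_iff[OF I'(1,3) ch] by (simp add: splitting_def)
qed (simp_all add: splitting_def splitting_hom_def comp_assoc u_obj)

text \<open>Between identity idempotents absorption is vacuous, so the hom-sets are exactly those of
  K and the inclusion is fully faithful.\<close>

lemma locally_continuous_inclusion:
  assumes i: "\<And>A. A \<in> obj K \<Longrightarrow> i A \<in> I" "\<And>A. A \<in> obj K \<Longrightarrow> u (i A) = A"
    "\<And>A. A \<in> obj K \<Longrightarrow> e (i A) = ident K A"
  shows "locally_continuous_functor K (splitting K I u e) \<lparr>fobj = i, fmor = (\<lambda>_ _ f. f)\<rparr>"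
proof -
  interpret L: O_category "splitting K I u e" by (rule O_category_splitting)
  have hom: "splitting_hom K u e (i A) (i B) = hom K A B"
    if "A \<in> obj K" "B \<in> obj K" for A B
    using that i by (auto simp: splitting_hom_def comp_ident_left comp_ident_right)
  show ?thesis
  proof
    fix A B S s
    assume ob: "A \<in> obj K" "B \<in> obj K" and S: "is_chain K A B S" "is_lub K A B S s"
    have "is_chain (splitting K I u e) (i A) (i B) S"
      using ob i S(1) hom[OF ob] by (simp add: splitting_chain_iff) (simp add: is_chain_def)
    then show "is_lub (splitting K I u e)
        (fobj \<lparr>fobj = i, fmor = (\<lambda>_ _ f. f)\<rparr> A) (fobj \<lparr>fobj = i, fmor = (\<lambda>_ _ f. f)\<rparr> B)
        (\<lambda>n. fmor \<lparr>fobj = i, fmor = (\<lambda>_ _ f. f)\<rparr> A B (S n))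
        (fmor \<lparr>fobj = i, fmor = (\<lambda>_ _ f. f)\<rparr> A B s)"
      using splitting_lub_iff[of "i A" "i B" S s] ob i S(2) by simp
  qed (auto simp: splitting_def i hom dest: hle_in_hom)
qed

end


section \<open>Preserved colimits are locally determined\<close>

text \<open>Preservation is needed only for the inclusion into one splitting. It adds a single
  object and reuses the morphisms of K, whence the types \<open>'o option\<close> and
  \<open>'m\<close>.\<close>

lemma (in projection_chain) preserved_imp_locally_determined:
  assumes c: "cocone C c"
    and pres: "\<And>(L :: ('o option, 'm) ocat) (F :: ('o, 'm, 'o option, 'm) func).
      O_category L \<Longrightarrow> locally_continuous_functor K L F \<Longrightarrow>
      is_colimit omega (PR L) (PR_func F \<circ>\<^sub>F \<Delta>)
        (fobj F C) (\<lambda>n. fmor (PR_func F) (fobj \<Delta> n) C (c n))"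
  shows "locally_determined K \<Delta> C c"
proof -
  note H = obj_chain cocone_obj[OF c] cocone_pair[OF c]
  note C = H(2)
  obtain p where p: "is_lub K C C (\<lambda>n. comp K C (fobj \<Delta> n) C (fst (c n)) (snd (c n))) p"
    using lub_exists[OF C C is_chain_cocones[OF c c]] by blast
  note p_hom = is_lub_in_hom[OF p]
  have pp: "comp K C C C p p = p"
    using is_lub_unique[OF C C lub_cocones_comp_lub[OF c c c p p] p] .
  have p_le: "(p, ident K C) \<in> hle K C C"
    by (rule is_lub_least[OF C C p]) (use H in auto)
  \<comment> \<open>Taking both cocones to be c gives p o c_m^L = c_m^L and c_m^R o p =
    c_m^R.\<close>
  note pc = lub_cocones_comp[OF c c p]
  \<comment> \<open>\<open>None\<close> is the new object splitting \<open>p\<close>;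
    \<open>Some A\<close> is the old object A with its identity.\<close>
  define I where "I = insert None (Some ` obj K)"
  define u where "u = case_option C id"
  define e where "e = case_option p (ident K)"
  have u_simps: "u None = C" "\<And>A. u (Some A) = A" and e_simps: "e None = p" "\<And>A. e (Some A) = ident K A"
    by (auto simp: u_def e_def)
  interpret S: idempotent_family K I u e
    by unfold_locales
      (auto simp: I_def u_simps e_simps C p_hom pp ident_in_hom comp_ident_left)
  define L where "L = splitting K I u e"
  define F :: "('o, 'm, 'o option, 'm) func" where "F = \<lparr>fobj = Some, fmor = (\<lambda>_ _ f. f)\<rparr>"
  interpret L: O_category L unfolding L_def by (rule S.O_category_splitting)
  interpret F: locally_continuous_functor K L F
    unfolding L_def F_def
    by (rule S.locally_continuous_inclusion) (auto simp: I_def u_simps e_simps)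
  interpret FP: is_functor "PR K" "PR L" "PR_func F" by (rule F.is_functor_PR)
  have F_simps: "fobj F = Some" "fmor F A B f = f" for A B f by (auto simp: F_def)
  have L_comp: "comp L X Y Z = comp K (u X) (u Y) (u Z)" for X Y Z
    by (simp add: L_def splitting_def)
  have colim: "is_colimit omega (PR L) (PR_func F \<circ>\<^sub>F \<Delta>) (Some C) c"
    using pres[OF L.O_category_axioms F.locally_continuous_functor_axioms]
    by (simp add: F_simps PR_func_def)
  let ?D = "PR_func F \<circ>\<^sub>F \<Delta>"
  have D_obj: "fobj ?D n = Some (fobj \<Delta> n)" and D_mor: "fmor ?D m n x = fmor \<Delta> m n x" for m n x
    by (auto simp: func_comp_def PR_func_def F_simps)
  have omega_obj: "n \<in> obj omega \<longleftrightarrow> True" for n by (simp add: omega_def)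
  \<comment> \<open>The identity of \<open>None\<close> is \<open>p\<close>, so the inequality
    required of a pair is c_n^L o c_n^R \<le> p, which holds since \<open>p\<close> is an upper
    bound; absorption is \<open>pc\<close>.\<close>
  have "c n \<in> projection_pairs L (Some (fobj \<Delta> n)) None" for n
    using H p_hom pc is_lub_upper[OF p, of n]
    by (auto simp: projection_pairs_def L_def splitting_def splitting_hom_def u_simps e_simps
        case_prod_beta comp_ident_left comp_ident_right pp comp_in_hom comp_assoc)
       (simp add: comp_assoc[symmetric] pc)
  then have "is_cocone omega (PR L) ?D None c"
    using cocone_natural[OF c]
    by (auto simp: is_cocone_omega_PR_iff D_obj D_mor L_comp u_simps)
       (simp add: L_def splitting_def I_def)
  then have "\<exists>k. k \<in> hom (PR L) (Some C) None \<and>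
      (\<forall>n. comp (PR L) (Some (fobj \<Delta> n)) (Some C) None k (c n) = c n)"
    using colim unfolding is_colimit_def Ball_def omega_obj D_obj by blast
  then obtain k where k: "k \<in> hom (PR L) (Some C) None"
      "\<And>n. comp (PR L) (Some (fobj \<Delta> n)) (Some C) None k (c n) = c n"
    by blast
  have k_hom: "fst k \<in> hom K C C" "snd k \<in> hom K C C"
    and k_id: "comp K C C C (snd k) (fst k) = ident K C"
    and pk: "comp K C C C p (fst k) = fst k" "comp K C C C (snd k) p = snd k"
    using k(1)
    by (auto simp: PR_def projection_pairs_def L_def splitting_def splitting_hom_def u_simps e_simps)
  \<comment> \<open>Both composites are p o p = p: the identity of \<open>None\<close> on one side,
    and below the identity of C on the other.\<close>
  have pair_p: "(p, p) \<in> projection_pairs L None (Some C)"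
    using p_hom pp p_le C
    by (simp add: projection_pairs_def L_def splitting_def splitting_hom_def u_simps e_simps
        comp_ident_left comp_ident_right ident_in_hom)
  have obL: "Some C \<in> obj L" "None \<in> obj L" using C by (auto simp: L_def splitting_def I_def)
  \<comment> \<open>Composing k with (p, p) gives (p o k^L, k^R o p), which is k itself by
    \<open>pk\<close>; so the same pair is an endomorphism of \<open>Some C\<close>.\<close>
  have "k \<in> hom (PR L) (Some C) (Some C)"
    using L.projection_pairs_comp[OF obL(1,2,1) _ pair_p, of k] k(1) pk
    by (simp add: PR_def L_comp u_simps)
  moreover have "comp (PR L) (Some (fobj \<Delta> n)) (Some C) (Some C) k (c n) = c n" for n
    using k(2)[of n] by (simp add: PR_def L_comp u_simps)
  moreover have "ident (PR L) (Some C) \<in> hom (PR L) (Some C) (Some C)"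
    using category.ident_in_hom[OF L.category_PR, of "Some C"] obL(1) by (simp add: PR_def)
  moreover have "comp (PR L) (Some (fobj \<Delta> n)) (Some C) (Some C) (ident (PR L) (Some C)) (c n) = c n"
    for n
    using H by (simp add: PR_def L_comp u_simps)
      (simp add: L_def splitting_def e_simps comp_ident_left comp_ident_right)
  moreover have "is_cocone omega (PR L) ?D (Some C) c"
    using colim by (simp add: is_colimit_def)
  \<comment> \<open>Both k and the identity mediate from the colimiting cocone c to itself.\<close>
  ultimately have "k = ident (PR L) (Some C)"
    using colim unfolding is_colimit_def D_obj by blast
  then have "fst k = ident K C" by (simp add: PR_def L_def splitting_def e_simps)
  \<comment> \<open>Now p = p o k^L = k^L, as k^L is the identity.\<close>
  then have "p = ident K C" using pk(1) p_hom C by (simp add: comp_ident_right)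
  with p show ?thesis by (simp add: locally_determined_def)
qed

text \<open>A quantifier in HOL ranges over fixed types. The equivalence tests preservation at the
  types that suffice for the converse; the second conjunct gives the forward direction for L over
  arbitrary types \<open>'p\<close> and \<open>'q\<close>.\<close>

theorem mainTheorem1:
  fixes K :: "('o, 'm) ocat"
    and \<Delta> :: "(nat, unit, 'o, 'm \<times> 'm) func"
    and C :: 'o and c :: "nat \<Rightarrow> 'm \<times> 'm"
  assumes "O_category K"
    and "is_functor omega (PR K) \<Delta>"
    and "is_colimit omega (PR K) \<Delta> C c"
  shows
    "(locally_determined K \<Delta> C c \<longleftrightarrow>
       (\<forall>(L :: ('o option, 'm) ocat) (F :: ('o, 'm, 'o option, 'm) func).
          O_category L \<longrightarrow> locally_continuous_functor K L F \<longrightarrow>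
          is_colimit omega (PR L) (PR_func F \<circ>\<^sub>F \<Delta>)
            (fobj F C) (\<lambda>n. fmor (PR_func F) (fobj \<Delta> n) C (c n))))
     \<and>
     (locally_determined K \<Delta> C c \<longrightarrow>
       (\<forall>(L :: ('p, 'q) ocat) (F :: ('o, 'm, 'p, 'q) func).
          O_category L \<longrightarrow> locally_continuous_functor K L F \<longrightarrow>
          is_colimit omega (PR L) (PR_func F \<circ>\<^sub>F \<Delta>)
            (fobj F C) (\<lambda>n. fmor (PR_func F) (fobj \<Delta> n) C (c n))))"
proof -
  interpret projection_chain K \<Delta>
    using assms(1,2) by (simp add: projection_chain_def)
  have c: "cocone C c" using assms(3) by (simp add: is_colimit_def)
  show ?thesis
    by (intro conjI iffI allI impI)
      (auto intro: preserved_imp_locally_determined[OF c]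
        locally_continuous_functor.preserves_locally_determined[OF _ assms(2) c])
qed

end
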